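(* Let $G$ be a finitely generated hyperbolic group with a fixed finite symmetric generating set $S$, and let $\delta\ge 0$, $\delta\in\frac12\mathbb Z$, be such that $G$ is $\delta$-hyperbolic with respect to $S$. Then $G$ has product shrinkage at most linear in the radii. More precisely, let $$\eta=\frac{1}{4\,|B_{4\delta+\varepsilon}|\,|B_{4\delta}|},$$ where $\varepsilon=0$ if the Cayley graph $\Gamma(G,S)$ is bipartite and $\varepsilon=1$ otherwise. If $n,k\ge0$ are integers and $U\subseteq B_n$ and $V\subseteq B_k$ are finite non-empty sets, then $$|UV|\ge\frac{\eta}{n+k+1}|U||V|.$$ In particular, $G$ has large product growth.
   Context: $d$ is the word metric on $G$ with respect to $S$, $|g|=d(1,g)$, $B_m=\{g\in G:|g|\le m\}$, and $UV=\{uv:u\in U,v\in V\}$. The Gromov product is $(x\mid y)_t=\frac12(d(x,t)+d(y,t)-d(x,y))$ for $x,y,t\in G$. The group $G$ is $\delta$-hyperbolic with respect to $S$ if $(x\mid z)_t\ge\min\{(x\mid y)_t,(y\mid z)_t\}-\delta$ for all $x,y,z,t\in G$. $G$ has large product growth if there exists a polynomial $P$ such that, for all $n,k$ and all finite subsets $U\subseteq B_n$ and $V\subseteq B_k$, $|UV|\ge\frac{|U|\,|V|}{P(n+k)}$. *)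

theory Defs
  imports Complex_Main "HOL-Algebra.Algebra" "HOL-Computational_Algebra.Polynomial"
begin

definition symmetric_generating_set :: "('a, 'b) monoid_scheme \<Rightarrow> 'a set \<Rightarrow> bool" where
  "symmetric_generating_set G S \<longleftrightarrow>
     S \<subseteq> carrier G \<and> (\<forall>s\<in>S. inv\<^bsub>G\<^esub> s \<in> S) \<and> generate G S = carrier G"

text \<open>Words use letters of \<open>S\<close> only, not inverses; the set \<open>S\<close> is always symmetric below.
  The value is meaningful for elements generated by \<open>S\<close>.\<close>

definition word_length :: "('a, 'b) monoid_scheme \<Rightarrow> 'a set \<Rightarrow> 'a \<Rightarrow> nat" where
  "word_length G S g =
     (LEAST n. \<exists>ws. set ws \<subseteq> S \<and> length ws = n \<and> foldr (\<otimes>\<^bsub>G\<^esub>) ws \<one>\<^bsub>G\<^esub> = g)"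

definition word_dist :: "('a, 'b) monoid_scheme \<Rightarrow> 'a set \<Rightarrow> 'a \<Rightarrow> 'a \<Rightarrow> nat" where
  "word_dist G S x y = word_length G S (inv\<^bsub>G\<^esub> x \<otimes>\<^bsub>G\<^esub> y)"

definition word_ball :: "('a, 'b) monoid_scheme \<Rightarrow> 'a set \<Rightarrow> real \<Rightarrow> 'a set" where
  "word_ball G S r = {g \<in> carrier G. real (word_dist G S \<one>\<^bsub>G\<^esub> g) \<le> r}"

definition gromov_product :: "('a, 'b) monoid_scheme \<Rightarrow> 'a set \<Rightarrow> 'a \<Rightarrow> 'a \<Rightarrow> 'a \<Rightarrow> real" where
  "gromov_product G S t x y =
     (real (word_dist G S x t) + real (word_dist G S y t) - real (word_dist G S x y)) / 2"

definition delta_hyperbolic :: "('a, 'b) monoid_scheme \<Rightarrow> 'a set \<Rightarrow> real \<Rightarrow> bool" where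
  "delta_hyperbolic G S \<delta> \<longleftrightarrow>
     (\<forall>x\<in>carrier G. \<forall>y\<in>carrier G. \<forall>z\<in>carrier G. \<forall>t\<in>carrier G.
        gromov_product G S t x z \<ge> min (gromov_product G S t x y) (gromov_product G S t y z) - \<delta>)"

text \<open>The Cayley graph is a simple graph: if \<open>S\<close> contains the identity, the loops it would
  produce are left out.\<close>

definition cayley_edges :: "('a, 'b) monoid_scheme \<Rightarrow> 'a set \<Rightarrow> 'a set set" where
  "cayley_edges G S = {{g, g \<otimes>\<^bsub>G\<^esub> s} | g s. g \<in> carrier G \<and> s \<in> S \<and> s \<noteq> \<one>\<^bsub>G\<^esub>}"

definition bipartite_graph :: "'v set \<Rightarrow> 'v set set \<Rightarrow> bool" where
  "bipartite_graph V E \<longleftrightarrow>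
     (\<exists>A B. A \<union> B = V \<and> A \<inter> B = {} \<and> (\<forall>e\<in>E. \<exists>a\<in>A. \<exists>b\<in>B. e = {a, b}))"

text \<open>Positivity of \<open>P\<close> at all possible values \<open>n + k\<close> is implicit in the quotient bound. Without
  it a zero or negative value of \<open>P\<close> would make the inequality vacuous.\<close>

definition large_product_growth :: "('a, 'b) monoid_scheme \<Rightarrow> 'a set \<Rightarrow> bool" where
  "large_product_growth G S \<longleftrightarrow>
     (\<exists>P :: real poly. (\<forall>m::nat. poly P (real m) > 0) \<and>
        (\<forall>(n::nat) (k::nat) U V.
           finite U \<and> finite V \<and> U \<subseteq> word_ball G S (real n) \<and> V \<subseteq> word_ball G S (real k) \<longrightarrow>
           real (card (U <#>\<^bsub>G\<^esub> V)) \<ge> real (card U) * real (card V) / poly P (real (n + k))))"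

end

theory Submission
  imports Defs
begin

text \<open>
  Write \<open>T\<close> for the set of inverses of the elements of \<open>U\<close>. For every \<open>g\<close> the products \<open>u v\<close> are also the
  products \<open>(u g) (g\<inverse> v)\<close>, so \<open>g\<close> may be chosen to make as many pairs as possible multiply almost
  without cancellation, which means that the Gromov product \<open>(u\<inverse> | v)\<close> at \<open>g\<close> is small. Call such
  pairs good. Two facts give the theorem.

  \<^item> A product has few good factorizations (\<open>card_near_geodesic\<close>). If \<open>p = u v\<close> comes from a good pair,
    then \<open>u g\<close> lies near a geodesic from \<open>\<one>\<close> to \<open>p\<close>. That geodesic has at most \<open>n + k + 1\<close> vertices, so
    there are at most \<open>(n + k + 1) |B(4 \<delta> + \<epsilon>)|\<close> such \<open>u\<close>, and \<open>p\<close> and \<open>u\<close> determine \<open>v\<close>.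

  \<^item> Some \<open>g\<close> makes a fraction \<open>1 / (4 |B(4 \<delta>)|)\<close> of all pairs good (\<open>many_pairs_through_point\<close>). In a
    tree one would take a centroid. Here, root the group at \<open>\<one>\<close> and, for a level \<open>i\<close>, consider the
    clusters of points whose Gromov product at \<open>\<one>\<close> with a given point is at least \<open>i\<close>. Take the last
    level \<open>i\<close> at which some cluster holds half of \<open>T\<close> or half of \<open>V\<close>, say of \<open>V\<close>. Geodesics from \<open>\<one>\<close> to
    the points of this cluster cross level \<open>i\<close> within distance \<open>4 \<delta>\<close> of one point, so
    one vertex \<open>g\<close> at level \<open>i\<close> is on the way to \<open>|V| / (2 |B(4 \<delta>)|)\<close> points \<open>y\<close> of \<open>V\<close>. At level \<open>i + 1\<close>
    every cluster holds less than half of \<open>T\<close>, so for each such \<open>y\<close> at least half of the \<open>x\<close> in \<open>T\<close>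
    part from \<open>y\<close> before that level, and then \<open>(x | y)\<close> at \<open>g\<close> is at most \<open>\<delta> + \<epsilon> / 2\<close>.

  The number \<open>\<epsilon>\<close> pays for rounding. Vertices of geodesics exist only at integer levels, while Gromov
  products are half-integers in general. In a bipartite Cayley graph every triangle has even
  perimeter, so Gromov products are integers and nothing is lost.
\<close>

section \<open>A pigeonhole principle\<close>

lemma popular_fibre:
  assumes "finite B" "B \<noteq> {}" "f ` A \<subseteq> B"
  obtains b where "b \<in> B" "card A \<le> card B * card {a \<in> A. f a = b}"
proof -
  define K where "K = Max ((\<lambda>b. card {a \<in> A. f a = b}) ` B)"
  have "K \<in> (\<lambda>b. card {a \<in> A. f a = b}) ` B"
    unfolding K_def using assms by (intro Max_in) auto
  then obtain b where b: "b \<in> B" "K = card {a \<in> A. f a = b}"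
    by auto
  have "A = (\<Union>b\<in>B. {a \<in> A. f a = b})"
    using assms(3) by auto
  then have "card A \<le> (\<Sum>b\<in>B. card {a \<in> A. f a = b})"
    using card_UN_le[OF assms(1), of "\<lambda>b. {a \<in> A. f a = b}"] by simp
  also have "\<dots> \<le> of_nat (card B) * K"
    by (rule sum_bounded_above) (use assms(1) in \<open>auto simp: K_def\<close>)
  finally show thesis
    using that b by simp
qed

section \<open>The word metric\<close>

locale word_metric_group = group G for G :: "('a, 'b) monoid_scheme" (structure) +
  fixes S :: "'a set"
  assumes finite_S: "finite S"
    and generating: "symmetric_generating_set G S"
begin

abbreviation dist :: "'a \<Rightarrow> 'a \<Rightarrow> nat" where "dist \<equiv> word_dist G S"
abbreviation len :: "'a \<Rightarrow> nat" where "len \<equiv> word_length G S"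
abbreviation ball :: "real \<Rightarrow> 'a set" where "ball \<equiv> word_ball G S"
abbreviation gromov :: "'a \<Rightarrow> 'a \<Rightarrow> 'a \<Rightarrow> real" where "gromov \<equiv> gromov_product G S"
abbreviation word :: "'a list \<Rightarrow> 'a" where "word ws \<equiv> foldr (\<otimes>) ws \<one>"

lemma mult_inv_cancel:
  assumes "g \<in> carrier G" "h \<in> carrier G"
  shows "g \<otimes> (inv g \<otimes> h) = h" "inv g \<otimes> (g \<otimes> h) = h"
  using assms by (simp_all add: m_assoc[symmetric])

lemma S_closed: "s \<in> S \<Longrightarrow> s \<in> carrier G"
  using generating by (auto simp: symmetric_generating_set_def)

lemma S_inv: "s \<in> S \<Longrightarrow> inv s \<in> S"
  using generating by (auto simp: symmetric_generating_set_def)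

lemma word_closed: "set ws \<subseteq> S \<Longrightarrow> word ws \<in> carrier G"
  by (induction ws) (auto simp: S_closed)

lemma word_append:
  "set us \<subseteq> S \<Longrightarrow> set ws \<subseteq> S \<Longrightarrow> word (us @ ws) = word us \<otimes> word ws"
proof (induction us)
  case Nil
  then show ?case by (simp add: word_closed)
next
  case (Cons s us)
  then show ?case by (simp add: S_closed word_closed m_assoc)
qed

lemma inv_word: "set ws \<subseteq> S \<Longrightarrow> inv (word ws) = word (rev (map (m_inv G) ws))"
proof (induction ws)
  case (Cons s ws)
  have "word (rev (map (m_inv G) ws) @ [inv s]) = word (rev (map (m_inv G) ws)) \<otimes> word [inv s]"
    using Cons.prems by (intro word_append) (auto simp: S_inv)
  then show ?case
    using Cons by (auto simp: S_closed word_closed inv_mult_group)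
qed auto

text \<open>Words need no inverse letters because \<open>S\<close> is symmetric; hence the length, defined as a least
  number, is attained by a word.\<close>

lemma exists_word:
  assumes "g \<in> carrier G"
  shows "\<exists>ws. set ws \<subseteq> S \<and> word ws = g"
proof -
  have "g \<in> generate G S"
    using assms generating by (auto simp: symmetric_generating_set_def)
  then show ?thesis
  proof (induction rule: generate.induct)
    case one
    show ?case by (rule exI[of _ "[]"]) auto
  next
    case (incl h)
    then show ?case by (intro exI[of _ "[h]"]) (auto simp: S_closed)
  next
    case (inv h)
    then show ?case by (intro exI[of _ "[inv h]"]) (auto simp: S_closed S_inv)
  next
    case (eng h1 h2)
    then obtain us ws where "set us \<subseteq> S" "word us = h1" "set ws \<subseteq> S" "word ws = h2"
      by auto
    then show ?case by (intro exI[of _ "us @ ws"]) (auto simp: word_append simp del: foldr_append)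
  qed
qed

lemma shortest_word:
  assumes "g \<in> carrier G"
  obtains ws where "set ws \<subseteq> S" "word ws = g" "length ws = len g"
proof -
  have "\<exists>ws. set ws \<subseteq> S \<and> length ws = len g \<and> word ws = g"
    unfolding word_length_def
    by (rule LeastI_ex[of "\<lambda>n. \<exists>ws. set ws \<subseteq> S \<and> length ws = n \<and> word ws = g"])
      (use exists_word[OF assms] in auto)
  then show thesis
    using that by auto
qed

lemma len_word_le: "set ws \<subseteq> S \<Longrightarrow> len (word ws) \<le> length ws"
  unfolding word_length_def by (rule Least_le) auto

lemma len_one: "len \<one> = 0"
  using len_word_le[of "[]"] by simp

lemma len_mult_le:
  assumes "g \<in> carrier G" "h \<in> carrier G"
  shows "len (g \<otimes> h) \<le> len g + len h"
proof -
  obtain us where us: "set us \<subseteq> S" "word us = g" "length us = len g"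
    using shortest_word assms by blast
  obtain ws where ws: "set ws \<subseteq> S" "word ws = h" "length ws = len h"
    using shortest_word assms by blast
  show ?thesis
    using len_word_le[of "us @ ws"] word_append[of us ws] us ws by (simp del: foldr_append)
qed

lemma len_inv_le:
  assumes "g \<in> carrier G"
  shows "len (inv g) \<le> len g"
proof -
  obtain ws where ws: "set ws \<subseteq> S" "word ws = g" "length ws = len g"
    using shortest_word assms by blast
  have "set (rev (map (m_inv G) ws)) \<subseteq> S"
    using ws(1) S_inv by auto
  then show ?thesis
    using len_word_le[of "rev (map (m_inv G) ws)"] inv_word[OF ws(1)] ws by simp
qed

lemma len_inv: "g \<in> carrier G \<Longrightarrow> len (inv g) = len g"
  using len_inv_le[of g] len_inv_le[of "inv g"] by simp

lemma dist_one: "g \<in> carrier G \<Longrightarrow> dist \<one> g = len g"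
  by (simp add: word_dist_def)

lemma dist_commute:
  assumes "g \<in> carrier G" "h \<in> carrier G"
  shows "dist g h = dist h g"
  using len_inv[of "inv g \<otimes> h"] assms by (simp add: word_dist_def inv_mult_group)

lemma dist_one_right: "g \<in> carrier G \<Longrightarrow> dist g \<one> = len g"
  by (simp add: dist_one dist_commute[of g \<one>])

lemma dist_triangle:
  assumes "x \<in> carrier G" "y \<in> carrier G" "z \<in> carrier G"
  shows "dist x z \<le> dist x y + dist y z"
proof -
  have "inv x \<otimes> z = (inv x \<otimes> y) \<otimes> (inv y \<otimes> z)"
    using assms by (simp add: m_assoc mult_inv_cancel)
  then show ?thesis
    unfolding word_dist_def using len_mult_le[of "inv x \<otimes> y" "inv y \<otimes> z"] assms by simp
qed

lemma dist_mult_left: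
  assumes "g \<in> carrier G" "x \<in> carrier G" "y \<in> carrier G"
  shows "dist (g \<otimes> x) (g \<otimes> y) = dist x y"
proof -
  have "inv (g \<otimes> x) \<otimes> (g \<otimes> y) = inv x \<otimes> y"
    using assms by (simp add: m_assoc inv_mult_group mult_inv_cancel)
  then show ?thesis
    by (simp add: word_dist_def)
qed

lemma mem_ball: "g \<in> ball r \<longleftrightarrow> g \<in> carrier G \<and> real (len g) \<le> r"
  by (auto simp: word_ball_def dist_one)

lemma finite_ball: "finite (ball r)"
proof (rule finite_surj)
  show "finite {ws. set ws \<subseteq> S \<and> length ws \<le> nat \<lfloor>r\<rfloor>}"
    using finite_S by (rule finite_lists_length_le)
  show "ball r \<subseteq> word ` {ws. set ws \<subseteq> S \<and> length ws \<le> nat \<lfloor>r\<rfloor>}"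
  proof
    fix g assume g: "g \<in> ball r"
    then obtain ws where ws: "set ws \<subseteq> S" "word ws = g" "length ws = len g"
      using shortest_word mem_ball by metis
    moreover have "length ws \<le> nat \<lfloor>r\<rfloor>"
      using g ws by (auto simp: mem_ball le_nat_floor)
    ultimately show "g \<in> word ` {ws. set ws \<subseteq> S \<and> length ws \<le> nat \<lfloor>r\<rfloor>}"
      by auto
  qed
qed

lemma one_in_ball: "r \<ge> 0 \<Longrightarrow> \<one> \<in> ball r"
  by (simp add: mem_ball len_one)

lemma card_ball_pos: "r \<ge> 0 \<Longrightarrow> card (ball r) > 0"
  using one_in_ball finite_ball by (auto simp: card_gt_0_iff)

lemma geodesic_point:
  assumes "g \<in> carrier G" "i \<le> len g"
  obtains p where "p \<in> carrier G" "len p = i" "len p + dist p g = len g"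
proof -
  obtain ws where ws: "set ws \<subseteq> S" "word ws = g" "length ws = len g"
    using shortest_word assms by blast
  have sub: "set (take i ws) \<subseteq> S" "set (drop i ws) \<subseteq> S"
    using ws(1) set_take_subset set_drop_subset by (meson subset_trans)+
  define p where "p = word (take i ws)"
  have p: "p \<in> carrier G"
    unfolding p_def using sub by (simp add: word_closed)
  have "g = p \<otimes> word (drop i ws)"
    unfolding p_def using sub ws(2) word_append[OF sub] by (simp del: foldr_append)
  then have "inv p \<otimes> g = word (drop i ws)"
    using p word_closed[OF sub(2)] by (simp add: mult_inv_cancel)
  then have "dist p g \<le> len g - i"
    unfolding word_dist_def using len_word_le[OF sub(2)] ws by simp
  moreover have "len p \<le> i"
    unfolding p_def using len_word_le[OF sub(1)] ws assms by simp
  moreover have "len g \<le> len p + dist p g"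
    using dist_triangle[of \<one> p g] p assms by (simp add: dist_one)
  ultimately show thesis
    using that[OF p] assms(2) by simp
qed

section \<open>Gromov products and parity\<close>

lemma gromov_nonneg:
  assumes "x \<in> carrier G" "y \<in> carrier G" "t \<in> carrier G"
  shows "gromov t x y \<ge> 0"
  using dist_triangle[of x t y] dist_commute[of t y] assms by (simp add: gromov_product_def)

lemma gromov_commute:
  assumes "x \<in> carrier G" "y \<in> carrier G"
  shows "gromov t x y = gromov t y x"
  using dist_commute[of x y] assms by (simp add: gromov_product_def)

lemma gromov_le_dist:
  assumes "x \<in> carrier G" "y \<in> carrier G" "t \<in> carrier G"
  shows "gromov t x y \<le> dist x t"
  using dist_triangle[of y x t] dist_commute[of x y] assms by (simp add: gromov_product_def)

lemma gromov_one:
  assumes "x \<in> carrier G" "y \<in> carrier G"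
  shows "gromov \<one> x y = (real (len x) + real (len y) - real (dist x y)) / 2"
  using assms dist_commute[of _ \<one>] by (simp add: gromov_product_def dist_one)

text \<open>The equation \<open>len p + dist p x = len x\<close> expresses that \<open>p\<close> lies on a geodesic from \<open>\<one>\<close> to \<open>x\<close>.\<close>

lemma gromov_geodesic:
  assumes "p \<in> carrier G" "x \<in> carrier G" "len p + dist p x = len x"
  shows "gromov \<one> p x = len p"
  using assms by (simp add: gromov_one flip: assms(3))

lemma gromov_mult_left:
  assumes "g \<in> carrier G" "x \<in> carrier G" "y \<in> carrier G" "t \<in> carrier G"
  shows "gromov (g \<otimes> t) (g \<otimes> x) (g \<otimes> y) = gromov t x y"
  using assms by (simp add: gromov_product_def dist_mult_left)

lemma gromov_change_base:
  assumes "x \<in> carrier G" "y \<in> carrier G" "g \<in> carrier G"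
  shows "gromov g x y = len g - gromov \<one> x g - gromov \<one> y g + gromov \<one> x y"
  using assms by (simp add: gromov_one gromov_product_def[of _ _ g] field_simps)

lemma frac_gromov_le_half: "frac (gromov t x y) \<le> 1 / 2"
proof -
  define m :: int where "m = int (dist x t) + int (dist y t) - int (dist x y)"
  have g: "gromov t x y = real_of_int m / 2"
    by (simp add: gromov_product_def m_def)
  have "real_of_int (m div 2) \<ge> real_of_int m / 2 - 1 / 2"
    by linarith
  moreover have "\<lfloor>real_of_int m / 2\<rfloor> = m div 2"
    using floor_divide_of_int_eq[of m 2] by simp
  ultimately show ?thesis
    unfolding frac_def g by linarith
qed

text \<open>Every edge changes the colour, so along a geodesic the colour records the parity of the distance.\<close>

lemma bipartite_colouring:
  assumes "bipartite_graph (carrier G) (cayley_edges G S)"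
  obtains A where "\<And>g h. g \<in> carrier G \<Longrightarrow> h \<in> carrier G \<Longrightarrow> (g \<in> A \<longleftrightarrow> h \<in> A) \<longleftrightarrow> even (dist g h)"
proof -
  obtain A B where AB: "A \<union> B = carrier G" "A \<inter> B = {}"
    and edges: "\<forall>e\<in>cayley_edges G S. \<exists>a\<in>A. \<exists>b\<in>B. e = {a, b}"
    using assms unfolding bipartite_graph_def by (elim exE conjE)
  have step: "(g \<otimes> s \<in> A) \<noteq> (g \<in> A)" if gs: "g \<in> carrier G" "s \<in> S" "s \<noteq> \<one>" for g s
  proof -
    have "{g, g \<otimes> s} \<in> cayley_edges G S"
      using gs unfolding cayley_edges_def by auto
    then obtain a b where "a \<in> A" "b \<in> B" "{g, g \<otimes> s} = {a, b}"
      using edges by (elim ballE[of _ _ "{g, g \<otimes> s}"]) auto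
    then show ?thesis
      using AB(2) by (auto simp: doubleton_eq_iff)
  qed
  have path: "(g \<in> A \<longleftrightarrow> g \<otimes> word ws \<in> A) \<longleftrightarrow> even (length ws)"
    if "g \<in> carrier G" "set ws \<subseteq> S" "\<one> \<notin> set ws" for g ws
    using that
  proof (induction ws arbitrary: g)
    case (Cons s ws)
    have s: "s \<in> S" "s \<noteq> \<one>" "s \<in> carrier G"
      using Cons.prems S_closed by auto
    have "g \<otimes> word (s # ws) = (g \<otimes> s) \<otimes> word ws"
      using Cons.prems s by (simp add: m_assoc word_closed)
    moreover have "(g \<otimes> s \<in> A \<longleftrightarrow> (g \<otimes> s) \<otimes> word ws \<in> A) \<longleftrightarrow> even (length ws)"
      using Cons s by auto
    ultimately show ?case
      using step[OF Cons.prems(1) s(1,2)] by auto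
  qed auto
  \<comment> \<open>The identity may be a letter, but not of a shortest word, so no step of a geodesic is a loop.\<close>
  have no_one: "\<one> \<notin> set ws" if ws: "set ws \<subseteq> S" "length ws = len (word ws)" for ws
  proof
    assume "\<one> \<in> set ws"
    then obtain us vs where uv: "ws = us @ \<one> # vs"
      by (meson split_list)
    then have sub: "set us \<subseteq> S" "set vs \<subseteq> S" "set (\<one> # vs) \<subseteq> S"
      using ws by auto
    have "word ws = word (us @ vs)"
      using uv word_append[OF sub(1,2)] word_append[OF sub(1,3)] sub
      by (simp add: word_closed del: foldr_append)
    then show False
      using len_word_le[of "us @ vs"] ws uv sub by simp
  qed
  have "(g \<in> A \<longleftrightarrow> h \<in> A) \<longleftrightarrow> even (dist g h)" if gh: "g \<in> carrier G" "h \<in> carrier G" for g h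
  proof -
    obtain ws where ws: "set ws \<subseteq> S" "word ws = inv g \<otimes> h" "length ws = dist g h"
      using shortest_word[of "inv g \<otimes> h"] gh unfolding word_dist_def by auto
    have "g \<otimes> word ws = h"
      using ws(2) gh by (simp add: mult_inv_cancel)
    then show ?thesis
      using path[OF gh(1) ws(1)] no_one[OF ws(1)] ws by (simp add: word_dist_def)
  qed
  then show thesis
    using that by blast
qed

text \<open>Around a triangle the colour changes an even number of times, so the perimeter is even; it differs
  from twice the Gromov product by an even number.\<close>

lemma frac_gromov_bipartite:
  assumes "bipartite_graph (carrier G) (cayley_edges G S)"
    and "x \<in> carrier G" "y \<in> carrier G" "t \<in> carrier G"
  shows "frac (gromov t x y) = 0"
proof -
  obtain A where A: "\<And>g h. g \<in> carrier G \<Longrightarrow> h \<in> carrier G \<Longrightarrow> (g \<in> A \<longleftrightarrow> h \<in> A) \<longleftrightarrow> even (dist g h)"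
    using bipartite_colouring[OF assms(1)] by blast
  have "even (int (dist x t) + int (dist y t) - int (dist x y))"
    using A[OF assms(2,4)] A[OF assms(3,4)] A[OF assms(2,3)] by auto
  then obtain m where "int (dist x t) + int (dist y t) - int (dist x y) = 2 * m"
    by blast
  then have "real (dist x t) + real (dist y t) - real (dist x y) = real_of_int (2 * m)"
    by linarith
  then have "gromov t x y = real_of_int m"
    by (simp add: gromov_product_def)
  then show ?thesis
    by simp
qed

end

section \<open>Hyperbolicity\<close>

text \<open>Geodesics have vertices at integer levels, and rounding a Gromov product down to such a level costs
  at most \<open>\<epsilon> / 2\<close>. Bipartiteness of the Cayley graph enters through this bound.\<close>

locale hyperbolic_group = word_metric_group G S for G :: "('a, 'b) monoid_scheme" (structure) and S +
  fixes \<delta> \<epsilon> :: real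
  assumes delta_nonneg: "\<delta> \<ge> 0"
    and hyperbolic: "delta_hyperbolic G S \<delta>"
    and rounding: "x \<in> carrier G \<Longrightarrow> y \<in> carrier G \<Longrightarrow> t \<in> carrier G \<Longrightarrow>
      frac (gromov_product G S t x y) \<le> \<epsilon> / 2"
begin

lemma eps_nonneg: "\<epsilon> \<ge> 0"
proof -
  have "frac (gromov \<one> \<one> \<one>) \<le> \<epsilon> / 2"
    by (rule rounding) auto
  moreover have "frac (gromov \<one> \<one> \<one>) \<ge> 0"
    by simp
  ultimately show ?thesis
    by linarith
qed

lemma gromov_min:
  assumes "x \<in> carrier G" "y \<in> carrier G" "z \<in> carrier G" "t \<in> carrier G"
  shows "min (gromov t x y) (gromov t y z) \<le> gromov t x z + \<delta>"
proof -
  have "gromov t x z \<ge> min (gromov t x y) (gromov t y z) - \<delta>"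
    using hyperbolic assms unfolding delta_hyperbolic_def by auto
  then show ?thesis
    by linarith
qed

text \<open>Two geodesics issuing from \<open>\<one>\<close> stay close up to the Gromov product of their ends: the chain
  \<open>p, x, y, q\<close> has consecutive Gromov products at least \<open>i\<close>, two uses of hyperbolicity give
  \<open>(p | q) \<ge> i - 2 \<delta>\<close>, and at level \<open>i\<close> this is a bound on the distance.\<close>

lemma geodesic_points_close:
  assumes carr: "x \<in> carrier G" "y \<in> carrier G" "p \<in> carrier G" "q \<in> carrier G"
    and p: "len p = i" "len p + dist p x = len x"
    and q: "len q = i" "len q + dist q y = len y"
    and xy: "real i \<le> gromov \<one> x y"
  shows "real (dist p q) \<le> 4 * \<delta>"
proof -
  have "gromov \<one> p x = i" "gromov \<one> q y = i"
    using p q carr by (auto simp: gromov_geodesic)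
  moreover have "gromov \<one> y q = gromov \<one> q y"
    using carr by (simp add: gromov_commute)
  moreover have "min (gromov \<one> p x) (gromov \<one> x y) \<le> gromov \<one> p y + \<delta>"
    "min (gromov \<one> p y) (gromov \<one> y q) \<le> gromov \<one> p q + \<delta>"
    by (rule gromov_min; use carr in simp)+
  moreover have "gromov \<one> p q = i - real (dist p q) / 2"
    using carr p q by (simp add: gromov_one field_simps)
  ultimately show ?thesis
    using xy delta_nonneg by (auto simp: min_def split: if_splits)
qed

text \<open>The points that a geodesic to \<open>x\<close> accompanies at least up to level \<open>i\<close>. In a tree rooted at \<open>\<one>\<close>
  this is the part of \<open>W\<close> below the vertex at level \<open>i\<close> on the way to \<open>x\<close>.\<close>

definition cluster :: "'a set \<Rightarrow> 'a \<Rightarrow> nat \<Rightarrow> 'a set" where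
  "cluster W x i = {w \<in> W. real i \<le> gromov \<one> x w}"

text \<open>Passing from a cluster to the points behind one exact vertex \<open>g\<close> costs the factor \<open>|B(4 \<delta>)|\<close>. In
  return \<open>(y | g) = |g|\<close> holds without an error term, which keeps the later Gromov products down to
  \<open>\<delta> + \<epsilon> / 2\<close>.\<close>

lemma popular_crossing_point:
  assumes V: "V \<subseteq> carrier G" "finite V" and x: "x \<in> carrier G" and ne: "cluster V x i \<noteq> {}"
  obtains g where "g \<in> carrier G" "len g = i"
    "card (cluster V x i) \<le> card (ball (4 * \<delta>)) * card {y \<in> V. len g + dist g y = len y}"
proof -
  have gle: "i \<le> len x" "i \<le> len y" if "y \<in> cluster V x i" for y
  proof -
    have y: "y \<in> carrier G" "real i \<le> gromov \<one> x y"
      using that V by (auto simp: cluster_def)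
    have "gromov \<one> x y \<le> len x" "gromov \<one> x y \<le> len y"
      using gromov_le_dist[of x y \<one>] gromov_le_dist[of y x \<one>] gromov_commute[of x y \<one>]
        dist_commute[of _ \<one>] x y by (simp_all add: dist_one)
    then show "i \<le> len x" "i \<le> len y"
      using y by linarith+
  qed
  \<comment> \<open>All crossing points are compared with the point \<open>p\<close> at level \<open>i\<close> on the way to \<open>x\<close>; relative
    to it they lie in one ball, where the pigeonhole principle selects \<open>b\<close>.\<close>
  obtain p where p: "p \<in> carrier G" "len p = i" "len p + dist p x = len x"
    using geodesic_point[OF x, of i] gle(1) ne by auto
  have "\<forall>y\<in>cluster V x i. \<exists>q. q \<in> carrier G \<and> len q = i \<and> len q + dist q y = len y"
  proof
    fix y assume y: "y \<in> cluster V x i"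
    then have "y \<in> carrier G"
      using V by (auto simp: cluster_def)
    then show "\<exists>q. q \<in> carrier G \<and> len q = i \<and> len q + dist q y = len y"
      using geodesic_point[of y i] gle(2)[OF y] by blast
  qed
  from bchoice[OF this] obtain q where
    "\<forall>y\<in>cluster V x i. q y \<in> carrier G \<and> len (q y) = i \<and> len (q y) + dist (q y) y = len y" ..
  then have q: "q y \<in> carrier G" "len (q y) = i" "len (q y) + dist (q y) y = len y"
    if "y \<in> cluster V x i" for y
    using that by auto
  have close: "(\<lambda>y. inv p \<otimes> q y) ` cluster V x i \<subseteq> ball (4 * \<delta>)"
  proof (rule image_subsetI)
    fix y assume y: "y \<in> cluster V x i"
    then have "y \<in> carrier G" "real i \<le> gromov \<one> x y"
      using V by (auto simp: cluster_def)
    then have "real (dist p (q y)) \<le> 4 * \<delta>"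
      using geodesic_points_close[OF x _ p(1) q(1)[OF y] p(2,3) q(2,3)[OF y]] by simp
    then show "inv p \<otimes> q y \<in> ball (4 * \<delta>)"
      using p q(1)[OF y] by (simp add: mem_ball word_dist_def)
  qed
  have "ball (4 * \<delta>) \<noteq> {}"
    using one_in_ball[of "4 * \<delta>"] delta_nonneg by auto
  then obtain b where b: "b \<in> ball (4 * \<delta>)"
    "card (cluster V x i) \<le> card (ball (4 * \<delta>)) * card {y \<in> cluster V x i. inv p \<otimes> q y = b}"
    by (rule popular_fibre[OF finite_ball _ close])
  define F where "F = {y \<in> cluster V x i. inv p \<otimes> q y = b}"
  have qF: "q y = p \<otimes> b" if "y \<in> F" for y
    using that p q(1)[of y] mult_inv_cancel(1)[of p "q y"] by (auto simp: F_def)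
  have "card (cluster V x i) > 0"
    using ne V(2) by (simp add: card_gt_0_iff cluster_def)
  then have "card F > 0"
    using b(2) unfolding F_def[symmetric] by (cases "card F") auto
  then have "F \<noteq> {}"
    by auto
  then obtain y where y: "y \<in> F" by auto
  then have g: "p \<otimes> b \<in> carrier G" "len (p \<otimes> b) = i"
    using qF[OF y] q[of y] by (auto simp: F_def)
  have "F \<subseteq> {y \<in> V. len (p \<otimes> b) + dist (p \<otimes> b) y = len y}"
  proof
    fix y assume y: "y \<in> F"
    then have "y \<in> cluster V x i" by (simp add: F_def)
    then show "y \<in> {y \<in> V. len (p \<otimes> b) + dist (p \<otimes> b) y = len y}"
      using q(3)[of y] qF[OF y] by (auto simp: cluster_def)
  qed
  then have "card F \<le> card {y \<in> V. len (p \<otimes> b) + dist (p \<otimes> b) y = len y}"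
    using V by (intro card_mono) auto
  then have "card (cluster V x i) \<le>
      card (ball (4 * \<delta>)) * card {y \<in> V. len (p \<otimes> b) + dist (p \<otimes> b) y = len y}"
    using b(2) unfolding F_def[symmetric] by (meson le_trans mult_le_mono2)
  then show thesis
    using that g by blast
qed

text \<open>Since \<open>g\<close> is on the way to \<open>y\<close>, moving the base point from \<open>\<one>\<close> to \<open>g\<close> turns the Gromov product into
  \<open>(x | y) - (x | g)\<close>, taken at \<open>\<one>\<close>. As \<open>(x | g) \<ge> min {(x | y), |g|} - \<delta>\<close> and \<open>(x | y)\<close> exceeds \<open>|g|\<close>
  at most by its fractional part, only \<open>\<delta> + \<epsilon> / 2\<close> remains.\<close>

lemma gromov_at_branch_point:
  assumes carr: "x \<in> carrier G" "y \<in> carrier G" "g \<in> carrier G"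
    and g: "len g + dist g y = len y" and xy: "gromov \<one> x y < len g + 1"
  shows "gromov g x y \<le> \<delta> + \<epsilon> / 2"
proof -
  have gy: "gromov \<one> y g = len g" "gromov \<one> g y = len g"
    using g carr by (simp_all add: gromov_geodesic gromov_commute[of y g])
  have "gromov \<one> x y - \<lfloor>gromov \<one> x y\<rfloor> \<le> \<epsilon> / 2"
    using rounding[of x y \<one>] carr by (simp add: frac_def)
  moreover have "\<lfloor>gromov \<one> x y\<rfloor> \<le> int (len g)"
    using xy by linarith
  ultimately have "gromov \<one> x y \<le> len g + \<epsilon> / 2"
    by linarith
  moreover have "min (gromov \<one> x y) (gromov \<one> y g) \<le> gromov \<one> x g + \<delta>"
    using carr by (intro gromov_min) auto
  moreover have "gromov g x y = gromov \<one> x y - gromov \<one> x g"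
    using gromov_change_base[of x y g] carr gy by simp
  ultimately show ?thesis
    using gy eps_nonneg by (auto simp: min_def split: if_splits)
qed

text \<open>The pairs whose connecting geodesic passes close to \<open>g\<close>.\<close>

definition pairs_through :: "'a \<Rightarrow> 'a set \<Rightarrow> 'a set \<Rightarrow> ('a \<times> 'a) set" where
  "pairs_through g T V = {(x, y) \<in> T \<times> V. gromov g x y \<le> \<delta> + \<epsilon> / 2}"

lemma card_pairs_through_commute:
  assumes "T \<subseteq> carrier G" "V \<subseteq> carrier G"
  shows "card (pairs_through g T V) = card (pairs_through g V T)"
proof (rule bij_betw_same_card)
  show "bij_betw prod.swap (pairs_through g T V) (pairs_through g V T)"
    using assms gromov_commute
    by (intro bij_betw_byWitness[where f' = prod.swap]) (auto simp: pairs_through_def subset_iff)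
qed

text \<open>The half cluster of \<open>V\<close> supplies the points \<open>y\<close> behind \<open>g\<close>. For each of them the points \<open>x\<close> outside
  the cluster of \<open>y\<close> at level \<open>i + 1\<close> are at least half of \<open>T\<close> and form good pairs with \<open>y\<close>. The two halves
  and the ball of crossing points make up the constant.\<close>

lemma many_pairs_through_crossing_point:
  assumes T: "T \<subseteq> carrier G" "finite T" and V: "V \<subseteq> carrier G" "finite V" "V \<noteq> {}"
    and heavy: "x0 \<in> carrier G" "card V \<le> 2 * card (cluster V x0 i)"
    and light: "\<And>x. x \<in> carrier G \<Longrightarrow> 2 * card (cluster T x (i + 1)) < card T"
  shows "\<exists>g\<in>carrier G. card T * card V \<le> 4 * card (ball (4 * \<delta>)) * card (pairs_through g T V)"
proof -
  have ne: "cluster V x0 i \<noteq> {}"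
    using heavy(2) V by (auto simp: card_gt_0_iff)
  obtain g where g: "g \<in> carrier G" "len g = i" and
    pop: "card (cluster V x0 i) \<le> card (ball (4 * \<delta>)) * card {y \<in> V. len g + dist g y = len y}"
    by (rule popular_crossing_point[OF V(1,2) heavy(1) ne])
  define Y where "Y = {y \<in> V. len g + dist g y = len y}"
  define D where "D y = T - cluster T y (i + 1)" for y
  have YV: "Y \<subseteq> V" "finite Y"
    using V by (auto simp: Y_def)
  have half: "card T \<le> 2 * card (D y)" if "y \<in> Y" for y
  proof -
    have "card (D y) = card T - card (cluster T y (i + 1))"
      unfolding D_def using T by (intro card_Diff_subset) (auto simp: cluster_def)
    moreover have "2 * card (cluster T y (i + 1)) < card T"
      using light that YV(1) V(1) by blast
    ultimately show ?thesis
      by linarith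
  qed
  have "prod.swap ` (SIGMA y:Y. D y) \<subseteq> pairs_through g T V"
  proof (clarsimp simp: pairs_through_def)
    fix x y assume y: "y \<in> Y" and x: "x \<in> D y"
    then have carr: "x \<in> carrier G" "y \<in> carrier G"
      using T V by (auto simp: Y_def D_def)
    have "gromov \<one> x y < len g + 1"
      using x g carr gromov_commute[of x y \<one>] by (auto simp: D_def cluster_def)
    then show "x \<in> T \<and> y \<in> V \<and> gromov g x y \<le> \<delta> + \<epsilon> / 2"
      using x y gromov_at_branch_point[OF carr g(1)] by (auto simp: D_def Y_def)
  qed
  then have "card (prod.swap ` (SIGMA y:Y. D y)) \<le> card (pairs_through g T V)"
    using T V by (intro card_mono) (auto intro: finite_subset[of _ "T \<times> V"] simp: pairs_through_def)
  then have "(\<Sum>y\<in>Y. card (D y)) \<le> card (pairs_through g T V)"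
    using YV T by (simp add: card_image D_def)
  moreover have "(\<Sum>y\<in>Y. card T) \<le> (\<Sum>y\<in>Y. 2 * card (D y))"
    using half by (rule sum_mono)
  moreover have "(\<Sum>y\<in>Y. 2 * card (D y)) = 2 * (\<Sum>y\<in>Y. card (D y))"
    by (simp add: sum_distrib_left)
  moreover have "(\<Sum>y\<in>Y. card T) = card T * card Y"
    by simp
  ultimately have TY: "card T * card Y \<le> 2 * card (pairs_through g T V)"
    by linarith
  have "card T * card V \<le> card T * (2 * (card (ball (4 * \<delta>)) * card Y))"
    using heavy(2) pop unfolding Y_def by (intro mult_le_mono2) linarith
  also have "\<dots> = 2 * card (ball (4 * \<delta>)) * (card T * card Y)"
    by simp
  also have "\<dots> \<le> 2 * card (ball (4 * \<delta>)) * (2 * card (pairs_through g T V))"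
    using TY by (rule mult_le_mono2)
  finally show ?thesis
    using g(1) by (intro bexI[of _ g]) auto
qed

text \<open>The last level with a heavy cluster in either set exists: at level \<open>0\<close> one cluster is all of \<open>V\<close>,
  and above the radius of a set its clusters are empty. Taking the last level for both sets at once
  guarantees that whichever set is heavy at that level, the other one is light just above it.\<close>

lemma many_pairs_through_point:
  assumes T: "T \<subseteq> carrier G" "finite T" "T \<noteq> {}" and V: "V \<subseteq> carrier G" "finite V" "V \<noteq> {}"
  shows "\<exists>g\<in>carrier G. card T * card V \<le> 4 * card (ball (4 * \<delta>)) * card (pairs_through g T V)"
proof -
  define heavy where "heavy W i \<longleftrightarrow> (\<exists>x\<in>carrier G. card W \<le> 2 * card (cluster W x i))" for W i
  have bound: "\<exists>b. \<forall>i. heavy W i \<longrightarrow> i \<le> b" if W: "W \<subseteq> carrier G" "finite W" "W \<noteq> {}" for W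
  proof (intro exI allI impI)
    fix i assume "heavy W i"
    then obtain x where x: "x \<in> carrier G" "card W \<le> 2 * card (cluster W x i)"
      by (auto simp: heavy_def)
    then have "cluster W x i \<noteq> {}"
      using W by (auto simp: card_gt_0_iff)
    then obtain w where w: "w \<in> W" "real i \<le> gromov \<one> x w"
      by (auto simp: cluster_def)
    then have "real i \<le> len w"
      using gromov_le_dist[of w x \<one>] gromov_commute[of x w \<one>] dist_commute[of w \<one>] x W
      by (auto simp: dist_one subset_iff)
    then show "i \<le> Max (len ` W)"
      using w W by (simp add: Max_ge_iff) blast
  qed
  obtain b b' where b: "\<And>i. heavy T i \<Longrightarrow> i \<le> b" "\<And>i. heavy V i \<Longrightarrow> i \<le> b'"
    using bound[OF T] bound[OF V] by auto
  define i where "i = (GREATEST i. heavy T i \<or> heavy V i)"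
  have "cluster V \<one> 0 = V"
    using V gromov_nonneg by (auto simp: cluster_def)
  then have "heavy V 0"
    unfolding heavy_def by (intro bexI[of _ \<one>]) auto
  have le: "j \<le> max b b'" if "heavy T j \<or> heavy V j" for j
    using that b by (auto simp: le_max_iff_disj)
  have i: "heavy T i \<or> heavy V i"
    unfolding i_def
    by (rule GreatestI_nat[where k = 0 and b = "max b b'"]) (use \<open>heavy V 0\<close> le in auto)
  have "\<not> (heavy T (i + 1) \<or> heavy V (i + 1))"
  proof
    assume "heavy T (i + 1) \<or> heavy V (i + 1)"
    then have "i + 1 \<le> i"
      unfolding i_def by (rule Greatest_le_nat) (rule le)
    then show False by simp
  qed
  then have light: "\<And>x. x \<in> carrier G \<Longrightarrow> 2 * card (cluster T x (i + 1)) < card T"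
    "\<And>x. x \<in> carrier G \<Longrightarrow> 2 * card (cluster V x (i + 1)) < card V"
    by (force simp: heavy_def not_le)+
  show ?thesis
    using i
  proof
    assume "heavy V i"
    then show ?thesis
      using many_pairs_through_crossing_point[OF T(1,2) V _ _ light(1)] by (auto simp: heavy_def)
  next
    assume "heavy T i"
    then show ?thesis
      using many_pairs_through_crossing_point[OF V(1,2) T _ _ light(2)]
        card_pairs_through_commute[OF T(1) V(1)] by (auto simp: heavy_def mult.commute)
  qed
qed

text \<open>Let \<open>u\<close> be counted here, put \<open>a = (u | p)\<close> at \<open>\<one>\<close>, and let \<open>q\<close> be the vertex at level \<open>\<lfloor>a\<rfloor>\<close> of a
  fixed geodesic from \<open>\<one>\<close> to \<open>p\<close>. One use of hyperbolicity at \<open>u\<close>, with \<open>q\<close> between \<open>\<one>\<close> and \<open>p\<close>, bounds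
  \<open>dist q u\<close> by \<open>(\<one> | p) + 2 \<delta>\<close>, taken at \<open>u\<close>, plus the rounding error of \<open>a\<close>. So \<open>u\<close> lies in a ball
  around one of \<open>len p + 1\<close> vertices.\<close>

lemma card_near_geodesic:
  assumes p: "p \<in> carrier G"
  defines "N \<equiv> {u \<in> carrier G. gromov u \<one> p \<le> \<delta> + \<epsilon> / 2}"
  shows "finite N" "card N \<le> (len p + 1) * card (ball (4 * \<delta> + \<epsilon>))"
proof -
  have "\<forall>j\<in>{..len p}. \<exists>q. q \<in> carrier G \<and> len q = j \<and> len q + dist q p = len p"
  proof
    fix j assume "j \<in> {..len p}"
    then have "j \<le> len p" by simp
    then obtain q where "q \<in> carrier G" "len q = j" "len q + dist q p = len p"
      by (rule geodesic_point[OF p])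
    then show "\<exists>q. q \<in> carrier G \<and> len q = j \<and> len q + dist q p = len p"
      by blast
  qed
  from bchoice[OF this] obtain q where
    "\<forall>j\<in>{..len p}. q j \<in> carrier G \<and> len (q j) = j \<and> len (q j) + dist (q j) p = len p" ..
  then have q: "q j \<in> carrier G" "len (q j) = j" "len (q j) + dist (q j) p = len p"
    if "j \<le> len p" for j
    using that by blast+
  define Q where "Q = (\<Union>j\<in>{..len p}. (\<otimes>) (q j) ` ball (4 * \<delta> + \<epsilon>))"
  have "card Q \<le> (\<Sum>j\<in>{..len p}. card ((\<otimes>) (q j) ` ball (4 * \<delta> + \<epsilon>)))"
    unfolding Q_def by (rule card_UN_le) simp
  also have "\<dots> \<le> of_nat (card {..len p}) * card (ball (4 * \<delta> + \<epsilon>))"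
    by (rule sum_bounded_above) (rule card_image_le[OF finite_ball])
  finally have card_Q: "card Q \<le> (len p + 1) * card (ball (4 * \<delta> + \<epsilon>))"
    by simp
  have "u \<in> Q" if u: "u \<in> carrier G" "gromov u \<one> p \<le> \<delta> + \<epsilon> / 2" for u
  proof -
    define a where "a = gromov \<one> u p"
    define j where "j = nat \<lfloor>a\<rfloor>"
    have a: "a \<ge> 0" "a \<le> len p"
      unfolding a_def using gromov_nonneg[of u p \<one>] gromov_le_dist[of p u \<one>]
        gromov_commute[of u p \<one>] dist_commute[of p \<one>] u p by (simp_all add: dist_one)
    have "a - \<lfloor>a\<rfloor> \<le> \<epsilon> / 2"
      using rounding[of u p \<one>] u p by (simp add: a_def frac_def)
    moreover have "real j = \<lfloor>a\<rfloor>"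
      using a(1) by (simp add: j_def)
    moreover have "\<lfloor>a\<rfloor> \<le> a"
      by (rule of_int_floor_le)
    ultimately have j: "real j \<le> a" "a - real j \<le> \<epsilon> / 2"
      by linarith+
    with a(2) have "j \<le> len p"
      by linarith
    note j = this j
    have dist_u: "dist \<one> u = len u" "dist \<one> (q j) = j" "dist p u = dist u p" "dist p (q j) = dist (q j) p"
      "dist u (q j) = dist (q j) u" "dist \<one> p = len p"
      using u p q(1,2)[OF j(1)] by (simp_all add: dist_one dist_one_right dist_commute)
    have qj: "real (dist (q j) p) = real (len p) - real j"
      using q(2,3)[OF j(1)] by linarith
    have "gromov u \<one> (q j) = (dist (q j) u + gromov u \<one> p + a - j) / 2"
      using u p q(1)[OF j(1)] dist_u unfolding a_def gromov_one[OF u(1) p]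
      by (simp add: gromov_product_def field_simps)
    moreover have "gromov u (q j) p = (dist (q j) u + gromov u \<one> p + j - a) / 2"
      using u p q(1)[OF j(1)] dist_u qj unfolding a_def gromov_one[OF u(1) p]
      by (simp add: gromov_product_def field_simps)
    moreover have "min (gromov u \<one> (q j)) (gromov u (q j) p) \<le> gromov u \<one> p + \<delta>"
      using u p q(1)[OF j(1)] by (intro gromov_min) auto
    ultimately have "real (dist (q j) u) \<le> 4 * \<delta> + \<epsilon>"
      using j u(2) delta_nonneg by (auto simp: min_def split: if_splits)
    then have "inv (q j) \<otimes> u \<in> ball (4 * \<delta> + \<epsilon>)"
      using u q(1)[OF j(1)] by (simp add: mem_ball word_dist_def)
    moreover have "u = q j \<otimes> (inv (q j) \<otimes> u)"
      using u q(1)[OF j(1)] by (simp add: mult_inv_cancel)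
    ultimately show "u \<in> Q"
      unfolding Q_def using j(1) by blast
  qed
  then have NQ: "N \<subseteq> Q"
    by (auto simp: N_def)
  have "finite Q"
    by (auto simp: Q_def finite_ball)
  then show "finite N"
    using NQ finite_subset by blast
  show "card N \<le> (len p + 1) * card (ball (4 * \<delta> + \<epsilon>))"
    using card_mono[OF \<open>finite Q\<close> NQ] card_Q by (rule le_trans)
qed

text \<open>Translating by \<open>u\<close> takes the triangle \<open>u\<inverse>, v, g\<close> to \<open>\<one>, u v, u g\<close>, so good pairs with product
  \<open>p\<close> correspond to elements \<open>u g\<close> near a geodesic from \<open>\<one>\<close> to \<open>p\<close>. Applying this to a most popular
  product \<open>p\<close> of good pairs is enough.\<close>

lemma product_set_bound:
  assumes U: "U \<subseteq> ball (real n)" and V: "V \<subseteq> ball (real k)"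
  shows "card U * card V \<le>
    4 * card (ball (4 * \<delta> + \<epsilon>)) * card (ball (4 * \<delta>)) * (n + k + 1) * card (U <#> V)"
proof (cases "U = {} \<or> V = {}")
  case False
  have fin: "finite U" "finite V"
    using U V finite_ball finite_subset by blast+
  have carr: "U \<subseteq> carrier G" "V \<subseteq> carrier G"
    using U V by (auto simp: mem_ball)
  define T where "T = m_inv G ` U"
  have T: "T \<subseteq> carrier G" "finite T" "T \<noteq> {}"
    using carr fin False by (auto simp: T_def)
  have cT: "card T = card U"
    unfolding T_def using carr inv_inj by (metis card_image inj_on_subset)
  obtain g where g: "g \<in> carrier G" and
    many: "card T * card V \<le> 4 * card (ball (4 * \<delta>)) * card (pairs_through g T V)"
    using many_pairs_through_point[OF T carr(2) fin(2)] False by blast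
  define f where "f = (\<lambda>(x, y). inv x \<otimes> y)"
  define A where "A = pairs_through g T V"
  have UV: "U <#> V = (\<lambda>(u, v). u \<otimes> v) ` (U \<times> V)"
    by (auto simp: set_mult_def)
  have fA: "f ` A \<subseteq> U <#> V"
    using carr by (auto simp: f_def A_def pairs_through_def T_def set_mult_def subset_iff)
  have "finite (U <#> V)" "U <#> V \<noteq> {}"
    using fin False by (auto simp: UV)
  then obtain p where p: "p \<in> U <#> V"
    and fib: "card A \<le> card (U <#> V) * card {a \<in> A. f a = p}"
    by (rule popular_fibre[OF _ _ fA])
  obtain u v where uv: "u \<in> U" "v \<in> V" "p = u \<otimes> v"
    using p by (auto simp: set_mult_def)
  have pc: "p \<in> carrier G"
    using uv carr by auto
  have "len p \<le> n + k"
    using len_mult_le[of u v] uv U V carr by (force simp: mem_ball)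
  define N where "N = {u \<in> carrier G. gromov u \<one> p \<le> \<delta> + \<epsilon> / 2}"
  have N: "finite N" "card N \<le> (len p + 1) * card (ball (4 * \<delta> + \<epsilon>))"
    unfolding N_def by (rule card_near_geodesic[OF pc])+
  have fibre: "x \<in> carrier G \<and> y \<in> carrier G \<and> inv x \<otimes> y = p \<and> gromov g x y \<le> \<delta> + \<epsilon> / 2"
    if "(x, y) \<in> {a \<in> A. f a = p}" for x y
    using that T(1) carr by (auto simp: A_def f_def pairs_through_def)
  have "card {a \<in> A. f a = p} \<le> card N"
  proof (rule card_inj_on_le[OF _ _ N(1)])
    show "inj_on (\<lambda>(x, y). inv x \<otimes> g) {a \<in> A. f a = p}"
    proof (rule inj_onI, clarify)
      fix x y x' y'
      assume xy: "(x, y) \<in> A" "p = f (x, y)" "(x', y') \<in> A" "f (x', y') = f (x, y)"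
        and eq: "inv x \<otimes> g = inv x' \<otimes> g"
      have *: "x \<in> carrier G" "y \<in> carrier G" "inv x \<otimes> y = p"
          "x' \<in> carrier G" "y' \<in> carrier G" "inv x' \<otimes> y' = p"
        using fibre[of x y] fibre[of x' y'] xy by auto
      then have "x = x'"
        using eq g by (metis inv_closed inv_inv r_cancel)
      moreover have "y = x \<otimes> p" "y' = x' \<otimes> p"
        using * mult_inv_cancel(1)[of x y] mult_inv_cancel(1)[of x' y'] by simp_all
      ultimately show "x = x' \<and> y = y'"
        by simp
    qed
    show "(\<lambda>(x, y). inv x \<otimes> g) ` {a \<in> A. f a = p} \<subseteq> N"
    proof (rule image_subsetI, clarify)
      fix x y assume "(x, y) \<in> A" "p = f (x, y)"
      then have xy: "x \<in> carrier G" "y \<in> carrier G" "inv x \<otimes> y = p" "gromov g x y \<le> \<delta> + \<epsilon> / 2"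
        using fibre[of x y] by auto
      have "gromov (inv x \<otimes> g) \<one> p = gromov g x y"
        using gromov_mult_left[of "inv x" x y g] xy g by simp
      then show "inv x \<otimes> g \<in> N"
        using xy g by (simp add: N_def)
    qed
  qed
  also have "\<dots> \<le> (n + k + 1) * card (ball (4 * \<delta> + \<epsilon>))"
    using N(2) \<open>len p \<le> n + k\<close> by (meson add_le_mono1 le_trans mult_le_mono1)
  finally have "card A \<le> card (U <#> V) * ((n + k + 1) * card (ball (4 * \<delta> + \<epsilon>)))"
    using fib by (meson le_trans mult_le_mono2)
  then have "4 * card (ball (4 * \<delta>)) * card A \<le>
      4 * card (ball (4 * \<delta>)) * (card (U <#> V) * ((n + k + 1) * card (ball (4 * \<delta> + \<epsilon>))))"
    by (rule mult_le_mono2)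
  also have "\<dots> =
      4 * card (ball (4 * \<delta> + \<epsilon>)) * card (ball (4 * \<delta>)) * (n + k + 1) * card (U <#> V)"
    by (simp only: mult_ac)
  finally show ?thesis
    using many unfolding A_def cT by linarith
qed auto

end

section \<open>Product growth\<close>

theorem theorem6p1:
  fixes G :: "('a, 'b) monoid_scheme" and S :: "'a set" and \<delta> :: real
  assumes "group G"
    and "finite S"
    and "symmetric_generating_set G S"
    and "\<delta> \<ge> 0"
    and "2 * \<delta> \<in> \<int>"
    and "delta_hyperbolic G S \<delta>"
  shows "let \<epsilon> = (if bipartite_graph (carrier G) (cayley_edges G S) then 0 else 1 :: real);
             \<eta> = 1 / (4 * real (card (word_ball G S (4 * \<delta> + \<epsilon>))) * real (card (word_ball G S (4 * \<delta>))))
         in (\<forall>(n::nat) (k::nat) U V.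
               U \<subseteq> word_ball G S (real n) \<and> V \<subseteq> word_ball G S (real k) \<and>
               finite U \<and> finite V \<and> U \<noteq> {} \<and> V \<noteq> {} \<longrightarrow>
               real (card (U <#>\<^bsub>G\<^esub> V)) \<ge> \<eta> / (real n + real k + 1) * real (card U) * real (card V))
            \<and> large_product_growth G S"
proof -
  define \<epsilon> :: real where
    "\<epsilon> = (if bipartite_graph (carrier G) (cayley_edges G S) then 0 else 1)"
  interpret group G by fact
  interpret word_metric_group G S
    by unfold_locales (use assms in auto)
  have "frac (gromov t x y) \<le> \<epsilon> / 2"
    if "x \<in> carrier G" "y \<in> carrier G" "t \<in> carrier G" for x y t
    using frac_gromov_bipartite[OF _ that] frac_gromov_le_half[of t x y]
    by (cases "bipartite_graph (carrier G) (cayley_edges G S)") (simp_all only: \<epsilon>_def if_True if_False)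
  then interpret hyperbolic_group G S \<delta> \<epsilon>
    by unfold_locales (use assms in auto)
  \<comment> \<open>The constant \<open>M\<close> is \<open>1 / \<eta>\<close>; the growth polynomial is \<open>M + M x\<close>, positive at every natural number.\<close>
  define M where "M = 4 * real (card (ball (4 * \<delta> + \<epsilon>))) * real (card (ball (4 * \<delta>)))"
  have "M > 0"
    unfolding M_def using card_ball_pos delta_nonneg eps_nonneg by simp
  have bound: "real (card U) * real (card V) \<le> M * (real n + real k + 1) * real (card (U <#>\<^bsub>G\<^esub> V))"
    if "U \<subseteq> ball (real n)" "V \<subseteq> ball (real k)" for U V and n k :: nat
  proof -
    have "real (card U * card V) \<le>
        real (4 * card (ball (4 * \<delta> + \<epsilon>)) * card (ball (4 * \<delta>)) * (n + k + 1) * card (U <#>\<^bsub>G\<^esub> V))"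
      using product_set_bound[OF that] by (rule of_nat_mono)
    then show ?thesis
      by (simp add: M_def algebra_simps)
  qed
  have "1 / M / (real n + real k + 1) * real (card U) * real (card V) \<le> real (card (U <#>\<^bsub>G\<^esub> V))"
    if "U \<subseteq> ball (real n)" "V \<subseteq> ball (real k)" for U V and n k :: nat
    using bound[OF that] \<open>M > 0\<close> by (simp add: divide_le_eq mult_ac)
  moreover have "large_product_growth G S"
    unfolding large_product_growth_def
  proof (intro exI[of _ "[:M, M:]"] conjI allI impI)
    fix m :: nat
    show "poly [:M, M:] (real m) > 0"
      using \<open>M > 0\<close> by (simp add: add_pos_nonneg)
  next
    fix n k :: nat and U V
    assume *: "finite U \<and> finite V \<and> U \<subseteq> ball (real n) \<and> V \<subseteq> ball (real k)"
    have "poly [:M, M:] (real (n + k)) = M * (real n + real k + 1)"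
      by (simp add: algebra_simps)
    moreover have "M * (real n + real k + 1) > 0"
      using \<open>M > 0\<close> by simp
    ultimately show "real (card (U <#>\<^bsub>G\<^esub> V)) \<ge>
        real (card U) * real (card V) / poly [:M, M:] (real (n + k))"
      using bound[of U n V k] * by (simp only: pos_divide_le_eq) (simp add: mult_ac)
  qed
  ultimately show ?thesis
    unfolding Let_def \<epsilon>_def[symmetric] M_def[symmetric] by blast
qed

end
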